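(* Let $\mathcal{A}$ be a parity automaton with costs over an alphabet $\Sigma_I\times\Sigma_O$ with $n$ states and $k$ colors (i.e., $|\Omega(Q)|=k$), let $L=L(\mathcal{A})$, and let $f$ be the constant delay function with $f(0)=2^{2n^4k^2+1}$. Then the following are equivalent: (1) Player $I$ wins $\Gamma_f(L(\mathcal{A}))$; (2) Player $I$ wins $\Gamma_{f'}(L(\mathcal{A}))$ for every delay function $f'$.
   Context: A parity automaton with costs is a tuple $\mathcal{A}=(Q,\Sigma,q_I,\delta,\Omega,\mathrm{Cst})$ with a finite set $Q$ of states, a finite alphabet $\Sigma$, an initial state $q_I$, a deterministic complete transition function $\delta\colon Q\times\Sigma\to Q$, a coloring $\Omega\colon Q\to\mathbb{N}$, and a cost function $\mathrm{Cst}$ assigning to every transition $(q,a,\delta(q,a))$ either $\epsilon$ or $\mathtt{i}$ (increment-transition). Throughout, $\Omega(Q)$ contains both an even and an odd color. The run on $a_0a_1\cdots$ is $(q_0,a_0,q_1)(q_1,a_1,q_2)\cdots$ with $q_0=q_I$, $q_{j+1}=\delta(q_j,a_j)$; the cost of a finite run is its number of increment-transitions. For odd $c$, $\mathrm{Ans}(c)=\{c'\in\Omega(Q)\mid c'>c,\ c'\text{ even}\}$. For an infinite run $\rho$ and $n$, $\mathrm{Cor}(\rho,n)=0$ if $\Omega(q_n)$ is even, and otherwise it is the minimal cost of $(q_n,a_n,q_{n+1})\cdots(q_{n'-1},a_{n'-1},q_{n'})$ over $n'>n$ with $\Omega(q_{n'})\in\mathrm{Ans}(\Omega(q_n))$ ($\min\emptyset=\infty$).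 The run is accepting if $\limsup_n\mathrm{Cor}(\rho,n)<\infty$; $L(\mathcal{A})$ is the set of infinite words whose run is accepting. A delay function is a map $f\colon\mathbb{N}\to\mathbb{N}\setminus\{0\}$; it is constant if $f(i)=1$ for every $i>0$. For $L\subseteq(\Sigma_I\times\Sigma_O)^\omega$, the delay game $\Gamma_f(L)$ is played in rounds $i=0,1,2,\ldots$: in round $i$, Player $I$ picks $u_i\in\Sigma_I^{f(i)}$, then Player $O$ picks $v_i\in\Sigma_O$. Player $O$ wins the play if the outcome, i.e., the word over $\Sigma_I\times\Sigma_O$ pairing $u_0u_1u_2\cdots$ and $v_0v_1v_2\cdots$ letterwise, is in $L$; otherwise Player $I$ wins. A strategy for Player $I$ is a map $\tau_I\colon\Sigma_O^*\to\Sigma_I^*$ with $|\tau_I(w)|=f(|w|)$; a strategy for Player $O$ is a map $\tau_O\colon\Sigma_I^*\to\Sigma_O$. A play is consistent with $\tau_I$ if $u_i=\tau_I(v_0\cdots v_{i-1})$ for all $i$, and with $\tau_O$ if $v_i=\tau_O(u_0\cdots u_i)$ for all $i$. A strategy is winning if every consistent play is won by its owner; a player wins the game if she has a winning strategy. *)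

theory Defs
  imports Main "HOL-Library.Extended_Nat" "HOL-Library.Liminf_Limsup"
begin

text \<open>A parity automaton with costs over alphabet 'a with state type 'q (finite):
  transition function delta, initial state qI, colouring Omega, and cost function Cst
  (Cst q a = True means the transition (q, a, delta q a) is an increment-transition).\<close>

primrec run :: "('q \<Rightarrow> 'a \<Rightarrow> 'q) \<Rightarrow> 'q \<Rightarrow> (nat \<Rightarrow> 'a) \<Rightarrow> nat \<Rightarrow> 'q" where
  "run delta qI w 0 = qI"
| "run delta qI w (Suc j) = delta (run delta qI w j) (w j)"

definition seg_cost :: "('q \<Rightarrow> 'a \<Rightarrow> 'q) \<Rightarrow> 'q \<Rightarrow> ('q \<Rightarrow> 'a \<Rightarrow> bool) \<Rightarrow> (nat \<Rightarrow> 'a) \<Rightarrow> nat \<Rightarrow> nat \<Rightarrow> nat" where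
  "seg_cost delta qI Cst w m m' = card {j. m \<le> j \<and> j < m' \<and> Cst (run delta qI w j) (w j)}"

definition Ans :: "('q \<Rightarrow> nat) \<Rightarrow> nat \<Rightarrow> nat set" where
  "Ans Omega c = {c' \<in> range Omega. c' > c \<and> even c'}"

definition Cor :: "('q \<Rightarrow> 'a \<Rightarrow> 'q) \<Rightarrow> 'q \<Rightarrow> ('q \<Rightarrow> nat) \<Rightarrow> ('q \<Rightarrow> 'a \<Rightarrow> bool) \<Rightarrow> (nat \<Rightarrow> 'a) \<Rightarrow> nat \<Rightarrow> enat" where
  "Cor delta qI Omega Cst w m =
     (if even (Omega (run delta qI w m)) then 0
      else (INF m' \<in> {m'. m < m' \<and> Omega (run delta qI w m') \<in> Ans Omega (Omega (run delta qI w m))}.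
              enat (seg_cost delta qI Cst w m m')))"

definition lang :: "('q \<Rightarrow> 'a \<Rightarrow> 'q) \<Rightarrow> 'q \<Rightarrow> ('q \<Rightarrow> nat) \<Rightarrow> ('q \<Rightarrow> 'a \<Rightarrow> bool) \<Rightarrow> (nat \<Rightarrow> 'a) set" where
  "lang delta qI Omega Cst = {w. limsup (\<lambda>m. Cor delta qI Omega Cst w m) < \<infinity>}"

definition delay_fun :: "(nat \<Rightarrow> nat) \<Rightarrow> bool" where
  "delay_fun f \<longleftrightarrow> (\<forall>i. f i > 0)"

definition constant_delay :: "(nat \<Rightarrow> nat) \<Rightarrow> bool" where
  "constant_delay f \<longleftrightarrow> delay_fun f \<and> (\<forall>i>0. f i = 1)"

text \<open>Outcome of a play: u i is Player I's block in round i, v i Player O's letter.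
  The j-th letter pairs the j-th letter of u 0 u 1 u 2 ... with v j.\<close>
definition outcome :: "(nat \<Rightarrow> 'i list) \<Rightarrow> (nat \<Rightarrow> 'o) \<Rightarrow> nat \<Rightarrow> 'i \<times> 'o" where
  "outcome u v j = (concat (map u [0..<Suc j]) ! j, v j)"

definition strategy_I :: "(nat \<Rightarrow> nat) \<Rightarrow> ('o list \<Rightarrow> 'i list) \<Rightarrow> bool" where
  "strategy_I f tau \<longleftrightarrow> (\<forall>w. length (tau w) = f (length w))"

definition consistent_I :: "('o list \<Rightarrow> 'i list) \<Rightarrow> (nat \<Rightarrow> 'i list) \<Rightarrow> (nat \<Rightarrow> 'o) \<Rightarrow> bool" where
  "consistent_I tau u v \<longleftrightarrow> (\<forall>i. u i = tau (map v [0..<i]))"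

definition wins_I :: "(nat \<Rightarrow> nat) \<Rightarrow> (nat \<Rightarrow> 'i \<times> 'o) set \<Rightarrow> bool" where
  "wins_I f L \<longleftrightarrow> (\<exists>tau. strategy_I f tau \<and>
      (\<forall>u v. consistent_I tau u v \<longrightarrow> outcome u v \<notin> L))"

end

theory Submission
  imports Defs
begin

text \<open>
  Split the initial lookahead into two blocks of equal length \<open>d\<close>. The type of an input block is the set of
  all possible effects of answering it: start state, end state, largest pending request, largest even colour, and
  whether an increment occurs. There are at most \<open>d\<close> types, so any block of length \<open>d\<close> can be pumped to
  an arbitrarily long block of the same type. Player I simulates her strategy for \<open>f\<close>, but plays pumped blocks
  long enough to cover the lookahead granted by \<open>f'\<close>, and translates each answer back to an answer of the
  short block with the same effect. Short blocks have bounded length, so bounded costs in the pumped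
  play give bounded costs in the simulated play; as the latter is lost by Player O, so is the former.
\<close>

section \<open>Acceptance as a bounded-response property of colours and increments\<close>

definition bounded_resp :: "(nat \<Rightarrow> nat) \<Rightarrow> (nat \<Rightarrow> bool) \<Rightarrow> bool" where
  "bounded_resp col inc \<longleftrightarrow> (\<exists>b M. \<forall>m\<ge>M. odd (col m) \<longrightarrow>
     (\<exists>m'>m. even (col m') \<and> col m < col m' \<and> card {j. m \<le> j \<and> j < m' \<and> inc j} \<le> b))"

lemma limsup_enat_finite_iff:
  fixes X :: "nat \<Rightarrow> enat"
  shows "limsup X < \<infinity> \<longleftrightarrow> (\<exists>b M. \<forall>m\<ge>M. X m \<le> enat b)"
proof
  assume "limsup X < \<infinity>"
  then obtain M where M: "(SUP m\<in>{M..}. X m) < \<infinity>"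
    unfolding limsup_INF_SUP INF_less_iff by blast
  then obtain b where "(SUP m\<in>{M..}. X m) = enat b"
    using less_infinityE by blast
  then show "\<exists>b M. \<forall>m\<ge>M. X m \<le> enat b"
    by (metis SUP_upper atLeast_iff)
next
  assume "\<exists>b M. \<forall>m\<ge>M. X m \<le> enat b"
  then obtain b M where "\<forall>m\<ge>M. X m \<le> enat b" by blast
  then have "(SUP m\<in>{M..}. X m) \<le> enat b" by (intro SUP_least) auto
  then have "limsup X \<le> enat b"
    unfolding limsup_INF_SUP by (meson INF_lower UNIV_I order_trans)
  then show "limsup X < \<infinity>" using enat_ord_simps(4) le_less_trans by blast
qed

lemma Cor_le_iff:
  "Cor delta qI Omega Cst w m \<le> enat b \<longleftrightarrow> (odd (Omega (run delta qI w m)) \<longrightarrow>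
     (\<exists>m'>m. even (Omega (run delta qI w m')) \<and> Omega (run delta qI w m) < Omega (run delta qI w m')
        \<and> seg_cost delta qI Cst w m m' \<le> b))"
proof -
  \<comment> \<open>Making the bound strict turns the infimum into the existence of a witness; the
    infimum of the empty set is infinite and correctly yields none.\<close>
  have *: "x \<le> enat b \<longleftrightarrow> x < enat (Suc b)" for x
    by (cases x) auto
  show ?thesis
    by (auto simp: Cor_def * INF_less_iff Ans_def less_Suc_eq_le zero_enat_def)
qed

lemma lang_iff:
  "w \<in> lang delta qI Omega Cst \<longleftrightarrow>
     bounded_resp (\<lambda>j. Omega (run delta qI w j)) (\<lambda>j. Cst (run delta qI w j) (w j))"
  unfolding lang_def mem_Collect_eq limsup_enat_finite_iff Cor_le_iff bounded_resp_def seg_cost_def ..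

section \<open>Block summaries\<close>

text \<open>A summary \<open>(p, e, z)\<close> records the largest pending request, the largest even colour (both shifted
  by one so that \<open>0\<close> means none), and whether an increment occurred.\<close>

definition upd :: "nat \<times> nat \<times> bool \<Rightarrow> nat \<times> bool \<Rightarrow> nat \<times> nat \<times> bool" where
  "upd s ci = (case s of (p, e, z) \<Rightarrow> case ci of (c, i) \<Rightarrow>
     (if even c then (if p < Suc c then 0 else p) else max p (Suc c),
      if even c then max e (Suc c) else e, z \<or> i))"

definition summary :: "(nat \<times> bool) list \<Rightarrow> nat \<times> nat \<times> bool" where
  "summary = foldl upd (0, 0, False)"

definition block_summary :: "(nat \<Rightarrow> nat) \<Rightarrow> (nat \<Rightarrow> bool) \<Rightarrow> nat \<Rightarrow> nat \<Rightarrow> nat \<times> nat \<times> bool" where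
  "block_summary col inc m m' = summary (map (\<lambda>j. (col j, inc j)) [m..<m'])"

lemma block_summary_refl [simp]: "block_summary col inc m m = (0, 0, False)"
  by (simp add: block_summary_def summary_def)

lemma block_summary_Suc:
  "m \<le> m' \<Longrightarrow> block_summary col inc m (Suc m') = upd (block_summary col inc m m') (col m', inc m')"
  by (simp add: block_summary_def summary_def)

lemma block_summary_inc:
  assumes "m \<le> m'"
  shows "snd (snd (block_summary col inc m m')) \<longleftrightarrow> (\<exists>j. m \<le> j \<and> j < m' \<and> inc j)"
  using assms
proof (induction m' rule: dec_induct)
  case (step n)
  then show ?case
    by (auto simp: block_summary_Suc upd_def less_Suc_eq split: prod.splits)
qed auto

text \<open>The extra \<open>Suc\<close> on the left undoes the shift by one in the stored colour.
  For a fixed request \<open>c\<close>, the summary thus tells whether the block contains an answer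
  to it.\<close>

lemma block_summary_even:
  assumes "m \<le> m'"
  shows "Suc c < fst (snd (block_summary col inc m m')) \<longleftrightarrow>
    (\<exists>j. m \<le> j \<and> j < m' \<and> even (col j) \<and> c < col j)"
  using assms
proof (induction m' rule: dec_induct)
  case (step n)
  then show ?case
    by (auto simp: block_summary_Suc upd_def less_Suc_eq less_max_iff_disj split: prod.splits)
qed auto

text \<open>Storing only the largest pending request suffices: an even colour that resets it exceeds
  it, hence would also answer every smaller request, including the one at \<open>i\<close>.\<close>

lemma block_summary_pending_upper:
  assumes "m \<le> m'" "m \<le> i" "i < m'" "odd (col i)"
    and "\<And>j. i < j \<Longrightarrow> j < m' \<Longrightarrow> even (col j) \<Longrightarrow> col j \<le> col i"
  shows "col i < fst (block_summary col inc m m')"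
  using assms
proof (induction m' rule: dec_induct)
  case (step n)
  show ?case
  proof (cases "i = n")
    case True
    then show ?thesis using step by (auto simp: block_summary_Suc upd_def split: prod.splits)
  next
    case False
    then have "col i < fst (block_summary col inc m n)"
      using step by auto
    moreover have "even (col n) \<Longrightarrow> col n \<le> col i" using step.prems False by auto
    moreover have "even (col n) \<Longrightarrow> col n \<noteq> col i" using step.prems by auto
    ultimately show ?thesis using step
      by (auto simp: block_summary_Suc upd_def split: prod.splits)
  qed
qed auto

lemma block_summary_pending_witness:
  assumes "m \<le> m'" "0 < fst (block_summary col inc m m')"
  shows "\<exists>i. m \<le> i \<and> i < m' \<and> odd (col i) \<and> fst (block_summary col inc m m') = Suc (col i) \<and>
    (\<forall>j. i < j \<and> j < m' \<and> even (col j) \<longrightarrow> col j \<le> col i)"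
  using assms
proof (induction m' rule: dec_induct)
  case (step n)
  obtain p e z where pez: "block_summary col inc m n = (p, e, z)" by (metis surj_pair)
  show ?case
  \<comment> \<open>Either position \<open>n\<close> attains the new maximum and is its own witness,
    or the old value survives together with its witness; a reset to 0 contradicts the
    premise.\<close>
  proof (cases "odd (col n) \<and> p \<le> Suc (col n)")
    case True
    then show ?thesis using step pez
      by (intro exI[of _ n]) (auto simp: block_summary_Suc upd_def)
  next
    case False
    with step.prems step.hyps pez
    have p: "fst (block_summary col inc m (Suc n)) = p" "0 < p" "even (col n) \<longrightarrow> Suc (col n) \<le> p"
      by (auto simp: block_summary_Suc upd_def split: if_splits)
    then obtain i where "m \<le> i" "i < n" "odd (col i)" "p = Suc (col i)"
      "\<forall>j. i < j \<and> j < n \<and> even (col j) \<longrightarrow> col j \<le> col i"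
      using step.IH pez by auto
    then show ?thesis using p by (intro exI[of _ i]) (auto simp: less_Suc_eq)
  qed
qed auto

lemma strict_mono_block:
  fixes B :: "nat \<Rightarrow> nat"
  assumes "strict_mono B" "B 0 = 0"
  obtains i where "B i \<le> t" "t < B (Suc i)"
proof -
  have "\<exists>i. B i \<le> t \<and> t < B (Suc i)"
  proof (induction t)
    case 0
    then show ?case using assms by (metis le0 lessI strict_mono_less)
  next
    case (Suc t)
    then obtain i where "B i \<le> t" "t < B (Suc i)" by blast
    moreover have "B (Suc i) < B (Suc (Suc i))" using assms by (simp add: strict_mono_less)
    ultimately show ?case by (cases "Suc t < B (Suc i)") (auto intro: exI[of _ i] exI[of _ "Suc i"])
  qed
  then show ?thesis using that by blast
qed

text \<open>A request surviving its own block is dominated by the pending request of the matching block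
  of the other sequence; the answer to the latter lies in a block that also contains an answer to the former.
  In between, only as many blocks contain increments as the cost of that answer.\<close>

lemma bounded_resp_transfer:
  assumes B: "strict_mono B" "B 0 = 0" and B': "strict_mono B'" "B' 0 = 0"
    and d: "\<And>i. B (Suc i) \<le> B i + d"
    and eq: "\<And>i. block_summary col inc (B i) (B (Suc i)) = block_summary col' inc' (B' i) (B' (Suc i))"
    and bounded: "bounded_resp col' inc'"
  shows "bounded_resp col inc"
proof -
  obtain b M where b: "\<And>m. m \<ge> M \<Longrightarrow> odd (col' m) \<Longrightarrow>
     \<exists>m'>m. even (col' m') \<and> col' m < col' m' \<and> card {j. m \<le> j \<and> j < m' \<and> inc' j} \<le> b"
    using bounded unfolding bounded_resp_def by blast
  have mono: "B i \<le> B j" "B' i \<le> B' j" if "i \<le> j" for i j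
    using that B B' by (simp_all add: strict_mono_less_eq)
  have blocks: "B i \<le> B (Suc i)" "B' i \<le> B' (Suc i)" for i using mono by auto
  \<comment> \<open>At most \<open>b + 2\<close> blocks contribute to the cost: the one of the
    request, the one of the answer, and up to \<open>b\<close> in between. Each has length at most
    \<open>d\<close>.\<close>
  have "\<exists>s>t. even (col s) \<and> col t < col s \<and> card {j. t \<le> j \<and> j < s \<and> inc j} \<le> (b + 2) * d"
    if t: "B M \<le> t" "odd (col t)" for t
  proof -
    obtain i where i: "B i \<le> t" "t < B (Suc i)" using strict_mono_block[OF B] .
    \<comment> \<open>The position threshold \<open>M\<close> is reused as a block index: the
      matching block then starts at \<open>B' i\<close>, which is at least \<open>i\<close> and so
      at least \<open>M\<close>.\<close>
    have "M \<le> i" using i t mono(1)[of "Suc i" M] by force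
    show ?thesis
    proof (cases "\<exists>s>t. s < B (Suc i) \<and> even (col s) \<and> col t < col s")
      case True
      then obtain s where s: "t < s" "s < B (Suc i)" "even (col s)" "col t < col s" by blast
      have "card {j. t \<le> j \<and> j < s \<and> inc j} \<le> card {B i..<B i + d}"
        using s i d[of i] by (intro card_mono) auto
      also have "\<dots> \<le> (b + 2) * d" by simp
      finally show ?thesis using s by blast
    next
      case False
      define p where "p = fst (block_summary col inc (B i) (B (Suc i)))"
      have tp: "col t < p" unfolding p_def
        using block_summary_pending_upper[of "B i" "B (Suc i)" t col, OF blocks(1) i t(2)] False not_le by blast
      obtain t' where t': "B' i \<le> t'" "t' < B' (Suc i)" "odd (col' t')" "p = Suc (col' t')"
        and unanswered: "\<forall>j. t' < j \<and> j < B' (Suc i) \<and> even (col' j) \<longrightarrow> col' j \<le> col' t'"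
        using block_summary_pending_witness[OF blocks(2), of col' inc' i] tp eq[of i]
        unfolding p_def by auto
      have "M \<le> t'" using \<open>M \<le> i\<close> t'(1) strict_mono_imp_increasing[OF B'(1), of i] by linarith
      then obtain s' where s': "t' < s'" "even (col' s')" "col' t' < col' s'"
        "card {j. t' \<le> j \<and> j < s' \<and> inc' j} \<le> b"
        using b t' by blast
      have s'i: "B' (Suc i) \<le> s'" using unanswered s' by force
      obtain k where k: "B' k \<le> s'" "s' < B' (Suc k)" using strict_mono_block[OF B'] .
      have "i < k" using k s'i mono(2)[of "Suc k" "Suc i"] by force
      have "Suc (col' t') < fst (snd (block_summary col' inc' (B' k) (B' (Suc k))))"
        using block_summary_even[OF blocks(2)] k s' by blast
      \<comment> \<open>The answer exceeds \<open>col' t'\<close>, hence also \<open>col t\<close>,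
        because \<open>col t < p\<close> and \<open>p = Suc (col' t')\<close>.\<close>
      then obtain s where s: "B k \<le> s" "s < B (Suc k)" "even (col s)" "col' t' < col s"
        using block_summary_even[OF blocks(1), of "col' t'" col inc k] eq by auto
      have "t < s" using i s mono(1)[of "Suc i" k] \<open>i < k\<close> by simp
      define Z where "Z = {l. i < l \<and> l < k \<and> snd (snd (block_summary col inc (B l) (B (Suc l))))}"
      have "\<forall>l\<in>Z. \<exists>j. B' l \<le> j \<and> j < B' (Suc l) \<and> inc' j"
        using block_summary_inc[OF blocks(2)] eq by (simp add: Z_def)
      \<comment> \<open>Choosing one increment from each incrementing block strictly between
        \<open>i\<close> and \<open>k\<close> maps \<open>Z\<close> injectively into the increments
        paid for in the primed sequence, so \<open>Z\<close> has at most \<open>b\<close>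
        elements.\<close>
      then obtain h where h: "\<And>l. l \<in> Z \<Longrightarrow> B' l \<le> h l \<and> h l < B' (Suc l) \<and> inc' (h l)"
        by metis
      have h_less: "h l < h l'" if "l \<in> Z" "l' \<in> Z" "l < l'" for l l'
        using h[OF that(1)] h[OF that(2)] mono(2)[of "Suc l" l'] that(3) by linarith
      have "inj_on h Z"
        using h_less by (intro inj_onI) (metis less_irrefl linorder_neqE_nat)
      moreover have "h ` Z \<subseteq> {j. t' \<le> j \<and> j < s' \<and> inc' j}"
      proof
        fix x assume "x \<in> h ` Z"
        then obtain l where l: "x = h l" "l \<in> Z" by blast
        then have "Suc i \<le> l" "Suc l \<le> k" by (auto simp: Z_def)
        then show "x \<in> {j. t' \<le> j \<and> j < s' \<and> inc' j}"
          using l h[OF l(2)] mono(2)[of "Suc i" l] mono(2)[of "Suc l" k] t' k by auto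
      qed
      ultimately have "card Z \<le> b"
        using s'(4) card_inj_on_le[of h Z "{j. t' \<le> j \<and> j < s' \<and> inc' j}"] by auto
      define Z' where "Z' = insert i (insert k Z)"
      have finZ: "finite Z" unfolding Z_def by simp
      have "card Z' \<le> Suc (Suc (card Z))"
        unfolding Z'_def using finZ by (simp add: card_insert_if)
      with \<open>card Z \<le> b\<close> have cardZ': "card Z' \<le> b + 2" by simp
      have fin: "finite Z'" using finZ by (simp add: Z'_def)
      have sub: "{j. t \<le> j \<and> j < s \<and> inc j} \<subseteq> (\<Union>l\<in>Z'. {B l..<B (Suc l)})"
      proof
        fix j assume j: "j \<in> {j. t \<le> j \<and> j < s \<and> inc j}"
        obtain l where l: "B l \<le> j" "j < B (Suc l)" using strict_mono_block[OF B] .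
        have "i \<le> l" using l j i mono(1)[of "Suc l" i] by force
        moreover have "l \<le> k" using l j s mono(1)[of "Suc k" l] by force
        ultimately have "l \<in> Z'"
          using block_summary_inc[OF blocks(1), of col inc l] l j
          by (auto simp: Z'_def Z_def)
        then show "j \<in> (\<Union>l\<in>Z'. {B l..<B (Suc l)})" using l by auto
      qed
      have "card {j. t \<le> j \<and> j < s \<and> inc j} \<le> card (\<Union>l\<in>Z'. {B l..<B (Suc l)})"
        using fin sub by (intro card_mono) auto
      also have "\<dots> \<le> (\<Sum>l\<in>Z'. card {B l..<B (Suc l)})" by (rule card_UN_le[OF fin])
      also have "\<dots> \<le> of_nat (card Z') * d"
        using d by (intro sum_bounded_above) (simp add: le_diff_conv add.commute)
      also have "\<dots> \<le> (b + 2) * d" using mult_le_mono1[OF cardZ'] by simp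
      finally show ?thesis using s \<open>t < s\<close> tp t'(4) by (intro exI[of _ s]) auto
    qed
  qed
  then show ?thesis unfolding bounded_resp_def by blast
qed

section \<open>Strategies as causal functions\<close>

definition lookahead :: "(nat \<Rightarrow> nat) \<Rightarrow> nat \<Rightarrow> nat" where
  "lookahead f r = (\<Sum>i<r. f i)"

text \<open>Player I's strategy seen as a map on whole infinite answer sequences: the letters she
  has played by the end of round \<open>r\<close> may depend only on the first \<open>r\<close>
  answers.\<close>

definition causal :: "(nat \<Rightarrow> nat) \<Rightarrow> ((nat \<Rightarrow> 'o) \<Rightarrow> nat \<Rightarrow> 'i) \<Rightarrow> bool" where
  "causal f X \<longleftrightarrow> (\<forall>v v' r j. (\<forall>t<r. v t = v' t) \<longrightarrow> j < lookahead f (Suc r) \<longrightarrow> X v j = X v' j)"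

lemma causalD:
  "causal f X \<Longrightarrow> (\<And>t. t < r \<Longrightarrow> v t = v' t) \<Longrightarrow> j < lookahead f (Suc r) \<Longrightarrow> X v j = X v' j"
  unfolding causal_def by blast

lemma lookahead_mono: "r \<le> s \<Longrightarrow> lookahead f r \<le> lookahead f s"
  unfolding lookahead_def by (intro sum_mono2) auto

lemma le_lookahead: "delay_fun f \<Longrightarrow> r \<le> lookahead f r"
proof (induction r)
  case (Suc r)
  then have "0 < f r" by (simp add: delay_fun_def)
  then show ?case using Suc by (simp add: lookahead_def)
qed simp

lemma concat_upt_nth:
  assumes "r \<le> s" "j < length (concat (map u [0..<r]))"
  shows "concat (map u [0..<s]) ! j = concat (map u [0..<r]) ! j"
proof -
  have "[0..<s] = [0..<r] @ [r..<s]" using assms(1) upt_add_eq_append[of 0 r "s - r"] by simp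
  then show ?thesis using assms(2) by (simp add: nth_append)
qed

definition extend :: "'o list \<Rightarrow> nat \<Rightarrow> 'o" where
  "extend w t = (if t < length w then w ! t else undefined)"

text \<open>Each answer sequence determines exactly one play consistent with a strategy, so a
  strategy amounts to its causal map from answers to inputs. This form hides the division into
  rounds, which differs between \<open>f\<close> and \<open>f'\<close>.\<close>

lemma wins_I_iff:
  fixes L :: "(nat \<Rightarrow> 'i \<times> 'o) set"
  assumes f: "delay_fun f"
  shows "wins_I f L \<longleftrightarrow> (\<exists>X. causal f X \<and> (\<forall>v. (\<lambda>j. (X v j, v j)) \<notin> L))"
proof
  assume "wins_I f L"
  then obtain tau :: "'o list \<Rightarrow> 'i list" where tau: "strategy_I f tau"
    and win: "\<And>u v. consistent_I tau u v \<Longrightarrow> outcome u v \<notin> L"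
    unfolding wins_I_def by blast
  define u where "u v i = tau (map v [0..<i])" for v i
  have len: "length (concat (map (u v) [0..<r])) = lookahead f r" for v r
    using tau by (induction r) (auto simp: u_def strategy_I_def lookahead_def)
  define X where "X v j = concat (map (u v) [0..<Suc j]) ! j" for v j
  have "X v j = X v' j" if v: "\<forall>t<r. v t = v' t" and j: "j < lookahead f (Suc r)" for v v' r j
  proof -
    \<comment> \<open>Letter \<open>j\<close> is read from the first \<open>Suc j\<close> blocks,
      which are long enough as blocks are nonempty; whichever of \<open>r\<close> and
      \<open>j\<close> is larger, the two concatenations agree at \<open>j\<close>.\<close>
    have "X v j = concat (map (u v) [0..<Suc r]) ! j" for v
    proof -
      have "j < lookahead f (Suc j)" using le_lookahead[OF f, of "Suc j"] by simp
      then show ?thesis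
        unfolding X_def using concat_upt_nth[of "Suc r" "Suc j" j "u v"] concat_upt_nth[of "Suc j" "Suc r" j "u v"]
          j unfolding len by (metis nle_le)
    qed
    moreover have "map (u v) [0..<Suc r] = map (u v') [0..<Suc r]"
    proof (intro map_cong refl)
      fix i assume "i \<in> set [0..<Suc r]"
      then have "map v [0..<i] = map v' [0..<i]" using v by auto
      then show "u v i = u v' i" unfolding u_def by (rule arg_cong)
    qed
    ultimately show ?thesis by metis
  qed
  then have "causal f X" unfolding causal_def by blast
  moreover have "(\<lambda>j. (X v j, v j)) \<notin> L" for v
  proof -
    have "consistent_I tau (u v) v" by (simp add: consistent_I_def u_def)
    moreover have "outcome (u v) v = (\<lambda>j. (X v j, v j))"
      unfolding outcome_def X_def ..
    ultimately show ?thesis using win by metis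
  qed
  ultimately show "\<exists>X. causal f X \<and> (\<forall>v. (\<lambda>j. (X v j, v j)) \<notin> L)" by blast
next
  assume "\<exists>X. causal f X \<and> (\<forall>v. (\<lambda>j. (X v j, v j)) \<notin> L)"
  then obtain X where X: "causal f X" and win: "\<And>v. (\<lambda>j. (X v j, v j)) \<notin> L" by blast
  \<comment> \<open>The finite history is padded arbitrarily; by causality the padding does not
    influence the letters of this round.\<close>
  define tau where "tau w = map (X (extend w)) [lookahead f (length w)..<lookahead f (Suc (length w))]" for w
  have "strategy_I f tau" by (auto simp: strategy_I_def tau_def lookahead_def)
  moreover have "outcome u v \<notin> L" if cons: "consistent_I tau u v" for u v
  proof -
    have u: "u i = map (X v) [lookahead f i..<lookahead f (Suc i)]" for i
    proof -
      have "X (extend (map v [0..<i])) j = X v j" if "j < lookahead f (Suc i)" for j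
        using that by (intro causalD[OF X, of i]) (auto simp: extend_def)
      then show ?thesis using cons by (auto simp: consistent_I_def tau_def)
    qed
    have concat: "concat (map u [0..<r]) = map (X v) [0..<lookahead f r]" for r
    proof (induction r)
      case (Suc r)
      have "[0..<lookahead f (Suc r)] = [0..<lookahead f r] @ [lookahead f r..<lookahead f (Suc r)]"
        using upt_add_eq_append[of 0 "lookahead f r" "f r"] by (simp add: lookahead_def)
      then show ?case using Suc u[of r] by simp
    qed (simp add: lookahead_def)
    have "outcome u v = (\<lambda>j. (X v j, v j))"
    proof
      fix j
      have "j < lookahead f (Suc j)" using le_lookahead[OF f, of "Suc j"] by simp
      then show "outcome u v j = (X v j, v j)" unfolding outcome_def concat by simp
    qed
    then show ?thesis using win by metis
  qed
  ultimately show "wins_I f L" unfolding wins_I_def by blast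
qed

section \<open>Infinite words as limits of growing lists\<close>

definition list_limit :: "(nat \<Rightarrow> 'a list) \<Rightarrow> nat \<Rightarrow> 'a" where
  "list_limit l j = l (Suc j) ! j"

lemma chain_prefix:
  assumes "\<And>i. l (Suc i) = l i @ z i" "i \<le> j"
  shows "\<exists>y. l j = l i @ y"
  using assms(2) by (induction j rule: dec_induct) (auto simp: assms(1))

lemma list_limit_nth:
  assumes l: "\<And>i. l (Suc i) = l i @ z i" and z: "\<And>i. z i \<noteq> []" and j: "j < length (l i)"
  shows "list_limit l j = l i ! j"
proof -
  have "i \<le> length (l i)" for i
  proof (induction i)
    case (Suc i)
    have "0 < length (z i)" using z by blast
    then show ?case using Suc l[of i] by (simp del: length_greater_0_conv)
  qed simp
  then have "j < length (l (Suc j))" by (metis Suc_le_eq)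
  then show ?thesis
    unfolding list_limit_def
    using chain_prefix[of l, OF l, of "Suc j" i] chain_prefix[of l, OF l, of i "Suc j"] j
    by (metis nle_le nth_append)
qed

lemma list_limit_segment:
  assumes l: "\<And>i. l (Suc i) = l i @ z i" and z: "\<And>i. z i \<noteq> []"
  shows "map (list_limit l) [length (l i)..<length (l (Suc i))] = z i"
proof (rule nth_equalityI)
  fix t assume "t < length (map (list_limit l) [length (l i)..<length (l (Suc i))])"
  then show "map (list_limit l) [length (l i)..<length (l (Suc i))] ! t = z i ! t"
    using list_limit_nth[of l, OF l z, of "length (l i) + t" "Suc i"] by (simp add: l nth_append)
qed (simp add: l)

section \<open>Pumping input blocks\<close>

locale cost_automaton =
  fixes delta :: "'q::finite \<Rightarrow> ('i::finite \<times> 'o::finite) \<Rightarrow> 'q"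
    and qI :: 'q and Omega :: "'q \<Rightarrow> nat" and Cst :: "'q \<Rightarrow> 'i \<times> 'o \<Rightarrow> bool"
begin

text \<open>The automaton extended by a running summary. The colour recorded is that of the state
  being left, so the end state of a block is counted in the next block.\<close>

definition step :: "'q \<times> nat \<times> nat \<times> bool \<Rightarrow> 'i \<times> 'o \<Rightarrow> 'q \<times> nat \<times> nat \<times> bool" where
  "step t a = (delta (fst t) a, upd (snd t) (Omega (fst t), Cst (fst t) a))"

definition eff :: "'q \<Rightarrow> ('i \<times> 'o) list \<Rightarrow> 'q \<times> nat \<times> nat \<times> bool" where
  "eff q = foldl step (q, 0, 0, False)"

lemma eff_run:
  assumes "m \<le> m'"
  shows "eff (run delta qI w m) (map w [m..<m']) = (run delta qI w m',
    block_summary (\<lambda>j. Omega (run delta qI w j)) (\<lambda>j. Cst (run delta qI w j) (w j)) m m')"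
  using assms
proof (induction m' rule: dec_induct)
  case (step n)
  then show ?case by (simp add: block_summary_Suc eff_def step_def)
qed (simp add: eff_def)

definition block_type :: "'i list \<Rightarrow> ('q \<times> 'q \<times> nat \<times> nat \<times> bool) set" where
  "block_type x = {(q, eff q (zip x y)) | q y. length y = length x}"

text \<open>An answer to a concatenation splits at the border. Hence the type of \<open>x\<close>
  determines the type of \<open>x @ z\<close>, and types behave like states of a deterministic
  automaton reading inputs.\<close>

lemma block_type_append:
  "block_type (x @ z) = {(q, foldl step t (zip z y)) | q t y. (q, t) \<in> block_type x \<and> length y = length z}"
    (is "?l = ?r")
proof
  show "?l \<subseteq> ?r"
  proof
    fix qt assume "qt \<in> ?l"
    then obtain q y where y: "qt = (q, eff q (zip (x @ z) y))" "length y = length x + length z"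
      by (auto simp: block_type_def)
    have "qt = (q, foldl step (eff q (zip x (take (length x) y))) (zip z (drop (length x) y)))"
      using y(1) by (simp add: zip_append1 eff_def)
    moreover have "(q, eff q (zip x (take (length x) y))) \<in> block_type x"
      using y by (auto simp: block_type_def intro!: exI[of _ "take (length x) y"])
    moreover have "length (drop (length x) y) = length z" using y by simp
    ultimately show "qt \<in> ?r" by blast
  qed
  show "?r \<subseteq> ?l"
  proof
    fix qt assume "qt \<in> ?r"
    then obtain q y1 y2 where "qt = (q, foldl step (eff q (zip x y1)) (zip z y2))"
      "length y1 = length x" "length y2 = length z"
      by (auto simp: block_type_def)
    then have "qt = (q, eff q (zip (x @ z) (y1 @ y2)))" "length (y1 @ y2) = length (x @ z)"
      by (auto simp: eff_def)
    then show "qt \<in> ?l" unfolding block_type_def by blast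
  qed
qed

lemma block_type_append_cong: "block_type x = block_type x' \<Longrightarrow> block_type (x @ z) = block_type (x' @ z)"
  by (simp add: block_type_append)

definition vals :: "nat set" where
  "vals = insert 0 (Suc ` range Omega)"

lemma eff_vals: "eff q w \<in> UNIV \<times> vals \<times> vals \<times> UNIV"
proof (induction w rule: rev_induct)
  case Nil
  then show ?case by (simp add: eff_def vals_def)
next
  case (snoc a w)
  obtain q' p e z where t: "eff q w = (q', p, e, z)" by (metis prod.exhaust)
  with snoc have "p \<in> vals" "e \<in> vals" by auto
  moreover have "Suc (Omega q') \<in> vals" "0 \<in> vals" by (auto simp: vals_def)
  moreover have "eff q (w @ [a]) = step (q', p, e, z) a" using t by (simp add: eff_def)
  ultimately show ?case by (auto simp: step_def upd_def max_def)
qed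

lemma finite_block_types: "finite (range block_type)"
  and card_block_types: "card (range block_type) \<le> 2 ^ (2 * card (UNIV :: 'q set) ^ 2 * Suc (card (range Omega)) ^ 2)"
proof -
  let ?S = "(UNIV :: 'q set) \<times> (UNIV :: 'q set) \<times> vals \<times> vals \<times> (UNIV :: bool set)"
  \<comment> \<open>A type is a set of tuples of two states, two shifted colours or 0, and one bit;
    the bound is the size of the powerset.\<close>
  have sub: "range block_type \<subseteq> Pow ?S" using eff_vals unfolding block_type_def by blast
  have fin: "finite ?S" by (simp add: vals_def)
  then show "finite (range block_type)" using sub finite_subset by blast
  have "card vals = Suc (card (range Omega))"
    unfolding vals_def by (subst card_insert_disjoint) (auto simp: card_image)
  then have "card ?S = 2 * card (UNIV :: 'q set) ^ 2 * Suc (card (range Omega)) ^ 2"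
    by (simp add: card_cartesian_product power2_eq_square del: mult_Suc mult_Suc_right)
  then show "card (range block_type) \<le> 2 ^ (2 * card (UNIV :: 'q set) ^ 2 * Suc (card (range Omega)) ^ 2)"
    using card_mono[OF _ sub] fin by (simp add: card_Pow)
qed

lemma pumping:
  assumes "card (range block_type) \<le> length x"
  shows "\<exists>x'. block_type x' = block_type x \<and> l \<le> length x'"
proof -
  \<comment> \<open>Counting the empty one, there are \<open>length x + 1\<close> prefixes, more
    than there are types, so two prefixes share a type and the factor \<open>y\<close> between them
    can be repeated.\<close>
  have "\<not> inj_on (\<lambda>i. block_type (take i x)) {..length x}"
  proof
    assume "inj_on (\<lambda>i. block_type (take i x)) {..length x}"
    then have "card {..length x} \<le> card (range block_type)"
      using finite_block_types by (intro card_inj_on_le) auto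
    then show False using assms by simp
  qed
  then obtain i j where ij: "i < j" "j \<le> length x" "block_type (take i x) = block_type (take j x)"
    unfolding inj_on_def by (metis atMost_iff linorder_neqE_nat)
  define y where "y = drop i (take j x)"
  have y: "take j x = take i x @ y"
    unfolding y_def using ij by (metis append_take_drop_id less_imp_le min.absorb1 take_take)
  have "y \<noteq> []" unfolding y_def using ij by simp
  have rep: "\<exists>z. block_type (take i x @ z) = block_type (take i x) \<and> l \<le> length z" for l
  proof (induction l)
    case 0
    then show ?case by (intro exI[of _ "[]"]) simp
  next
    case (Suc l)
    then obtain z where z: "block_type (take i x @ z) = block_type (take i x)" "l \<le> length z" by blast
    have "block_type (take i x @ z @ y) = block_type (take i x)"
      using block_type_append_cong[OF z(1), of y] ij(3) y by simp
    moreover have "Suc l \<le> length (z @ y)"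
      using z(2) \<open>y \<noteq> []\<close> by (cases y) auto
    ultimately show ?case by blast
  qed
  obtain z where z: "block_type (take i x @ z) = block_type (take i x)" "l \<le> length z" using rep by blast
  have "block_type ((take i x @ z) @ drop j x) = block_type (take j x @ drop j x)"
    using z(1) ij(3) by (intro block_type_append_cong) simp
  then show ?thesis using z(2) by (intro exI[of _ "(take i x @ z) @ drop j x"]) simp
qed

section \<open>Strategy transfer\<close>

definition pumped :: "'i list \<Rightarrow> nat \<Rightarrow> 'i list" where
  "pumped x l = (SOME x'. block_type x' = block_type x \<and> l \<le> length x')"

definition answer :: "'q \<Rightarrow> 'i list \<Rightarrow> ('i \<times> 'o) list \<Rightarrow> 'o list" where
  "answer q x w = (SOME y. length y = length x \<and> eff q (zip x y) = eff q w)"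

lemma pumped:
  assumes "card (range block_type) \<le> length x"
  shows "block_type (pumped x l) = block_type x" "l \<le> length (pumped x l)"
  using someI_ex[OF pumping[OF assms, of l]] by (simp_all add: pumped_def)

text \<open>Equal types offer the same effects from every start state, so each answer to
  \<open>x'\<close> has a counterpart on \<open>x\<close>.\<close>

lemma answer:
  assumes "block_type x' = block_type x" "length y' = length x'"
  shows "length (answer q x (zip x' y')) = length x"
    "eff q (zip x (answer q x (zip x' y'))) = eff q (zip x' y')"
proof -
  have "(q, eff q (zip x' y')) \<in> block_type x"
    using assms unfolding assms(1)[symmetric] block_type_def by blast
  then have "\<exists>y. length y = length x \<and> eff q (zip x y) = eff q (zip x' y')"
    by (auto simp: block_type_def)
  from someI_ex[OF this]
  show "length (answer q x (zip x' y')) = length x"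
    "eff q (zip x (answer q x (zip x' y'))) = eff q (zip x' y')"
    by (simp_all add: answer_def)
qed

context
  fixes X :: "(nat \<Rightarrow> 'o) \<Rightarrow> nat \<Rightarrow> 'i" and d :: nat and g :: "nat \<Rightarrow> nat"
begin

text \<open>Stage \<open>i\<close> consists of the translated answers to the first \<open>i - 1\<close> and to the first \<open>i\<close> blocks,
  the first \<open>i\<close> pumped blocks, and the state reached. Block \<open>i\<close> is computed from the former answers only,
  since it must be fixed before the answer to block \<open>i - 1\<close> is known.\<close>

definition in_block :: "'o list \<Rightarrow> nat \<Rightarrow> 'i list" where
  "in_block Y0 i = map (X (extend Y0)) [d * i..<d * Suc i]"

text \<open>With \<open>g\<close> instantiated to \<open>lookahead f'\<close>, this block alone is
  longer than everything Player I has to play before round \<open>length P\<close>.\<close>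

definition pumped_block :: "'o list \<Rightarrow> nat \<Rightarrow> 'i list \<Rightarrow> 'i list" where
  "pumped_block Y0 i P = pumped (in_block Y0 i) (Suc (g (length P)))"

definition played :: "(nat \<Rightarrow> 'o) \<Rightarrow> 'o list \<Rightarrow> nat \<Rightarrow> 'i list \<Rightarrow> ('i \<times> 'o) list" where
  "played v Y0 i P =
     zip (pumped_block Y0 i P) (map v [length P..<length P + length (pumped_block Y0 i P)])"

primrec stage :: "(nat \<Rightarrow> 'o) \<Rightarrow> nat \<Rightarrow> 'o list \<times> 'o list \<times> 'i list \<times> 'q" where
  "stage v 0 = ([], [], [], qI)"
| "stage v (Suc i) = (case stage v i of (Y0, Y, P, q) \<Rightarrow>
     (Y, Y @ answer q (in_block Y0 i) (played v Y0 i P),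
      P @ pumped_block Y0 i P, fst (eff q (played v Y0 i P))))"

definition replies :: "(nat \<Rightarrow> 'o) \<Rightarrow> nat \<Rightarrow> 'o list" where
  "replies v i = fst (snd (stage v i))"

definition inputs :: "(nat \<Rightarrow> 'o) \<Rightarrow> nat \<Rightarrow> 'i list" where
  "inputs v i = fst (snd (snd (stage v i)))"

definition state :: "(nat \<Rightarrow> 'o) \<Rightarrow> nat \<Rightarrow> 'q" where
  "state v i = snd (snd (snd (stage v i)))"

definition source :: "(nat \<Rightarrow> 'o) \<Rightarrow> nat \<Rightarrow> 'i list" where
  "source v i = in_block (replies v (i - 1)) i"

definition target :: "(nat \<Rightarrow> 'o) \<Rightarrow> nat \<Rightarrow> 'i list" where
  "target v i = pumped_block (replies v (i - 1)) i (inputs v i)"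

definition target_play :: "(nat \<Rightarrow> 'o) \<Rightarrow> nat \<Rightarrow> ('i \<times> 'o) list" where
  "target_play v i = played v (replies v (i - 1)) i (inputs v i)"

definition reply :: "(nat \<Rightarrow> 'o) \<Rightarrow> nat \<Rightarrow> 'o list" where
  "reply v i = answer (state v i) (source v i) (target_play v i)"

text \<open>Truncated subtraction covers stage 0: \<open>0 - 1\<close> is 0, and
  \<open>replies v 0\<close> is empty.\<close>

lemma stage_eq: "stage v i = (replies v (i - 1), replies v i, inputs v i, state v i)"
  by (cases i) (auto simp: replies_def inputs_def state_def split: prod.splits)

lemma stage_0 [simp]: "replies v 0 = []" "inputs v 0 = []" "state v 0 = qI"
  by (simp_all add: replies_def inputs_def state_def)

lemma stage_Suc:
  "replies v (Suc i) = replies v i @ reply v i"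
  "inputs v (Suc i) = inputs v i @ target v i"
  "state v (Suc i) = fst (eff (state v i) (target_play v i))"
  using stage_eq[of v i] stage_eq[of v "Suc i"]
  by (simp_all add: reply_def target_def target_play_def source_def)

lemma target_play_eq:
  "target_play v i = zip (target v i) (map v [length (inputs v i)..<length (inputs v (Suc i))])"
  by (simp add: target_play_def played_def stage_Suc target_def)

lemma stage_local:
  assumes "\<And>t. t < length (inputs v i) \<Longrightarrow> v t = v' t"
  shows "stage v i = stage v' i"
  using assms
proof (induction i)
  case (Suc i)
  have st: "stage v i = stage v' i" using Suc by (simp add: stage_Suc)
  then have eqs: "replies v (i - 1) = replies v' (i - 1)" "replies v i = replies v' i"
      "inputs v i = inputs v' i" "state v i = state v' i"
    by (simp_all add: stage_eq)
  have "target v i = target v' i" unfolding target_def eqs ..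
  moreover have "map v [length (inputs v i)..<length (inputs v (Suc i))] =
      map v' [length (inputs v i)..<length (inputs v (Suc i))]"
    using Suc.prems by (intro map_cong) auto
  ultimately have "target_play v i = target_play v' i"
    using \<open>target v i = target v' i\<close> by (simp only: target_play_eq stage_Suc eqs)
  with \<open>target v i = target v' i\<close> show ?case
    by (simp only: stage_eq[of _ "Suc i"] stage_Suc reply_def source_def eqs diff_Suc_1)
qed simp

text \<open>Stage \<open>i\<close> already fixes two further blocks: block \<open>i\<close> needs
  the translated answers to \<open>i - 1\<close> blocks, and block \<open>i + 1\<close> those to
  \<open>i\<close> blocks.\<close>

lemma inputs_local:
  assumes "\<And>t. t < length (inputs v i) \<Longrightarrow> v t = v' t"
  shows "inputs v (Suc (Suc i)) = inputs v' (Suc (Suc i))"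
  using stage_local[OF assms] by (simp add: stage_eq stage_Suc target_def)

section \<open>Correctness of the simulation\<close>

context
  fixes v :: "nat \<Rightarrow> 'o"
  assumes d: "card (range block_type) \<le> d" "0 < d"
begin

lemma length_source [simp]: "length (source v i) = d"
  by (simp add: source_def in_block_def)

lemma target:
  "block_type (target v i) = block_type (source v i)" "g (length (inputs v i)) < length (target v i)"
  using pumped[of "source v i" "Suc (g (length (inputs v i)))"] d
  by (simp_all add: target_def pumped_block_def Suc_le_eq flip: source_def del: One_nat_def)

lemma reply:
  "length (reply v i) = d"
  "eff (state v i) (zip (source v i) (reply v i)) = eff (state v i) (target_play v i)"
  using answer[OF target(1), of "map v [length (inputs v i)..<length (inputs v (Suc i))]" i "state v i"]
  by (simp_all add: reply_def target_play_eq stage_Suc)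

lemma length_replies: "length (replies v i) = d * i"
  by (induction i) (simp_all add: stage_Suc reply)

lemma strict_mono_inputs: "strict_mono (\<lambda>i. length (inputs v i))"
  unfolding strict_mono_Suc_iff
proof
  show "length (inputs v i) < length (inputs v (Suc i))" for i
    using target(2)[of i] by (auto simp: stage_Suc)
qed

lemma target_nonempty: "target v i \<noteq> []" and reply_nonempty: "reply v i \<noteq> []"
  using target(2)[of i] reply(1)[of i] d(2) by (metis list.size(3) not_less_zero)+

lemma limit_source:
  assumes X: "causal f X" and f: "\<And>r. 2 * d + r \<le> lookahead f (Suc r)"
  shows "map (X (list_limit (replies v))) [d * i..<d * Suc i] = source v i"
proof -
  have "X (list_limit (replies v)) j = X (extend (replies v (i - 1))) j" if "j < d * Suc i" for j
  proof (rule causalD[OF X, of "d * (i - 1)"])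
    show "list_limit (replies v) t = extend (replies v (i - 1)) t" if "t < d * (i - 1)" for t
      using that list_limit_nth[of "replies v", OF stage_Suc(1) reply_nonempty, of t "i - 1"]
      by (simp add: extend_def length_replies)
    \<comment> \<open>Here the two blocks of initial lookahead are used: after
      \<open>d * (i - 1)\<close> answers, the input is known up to the end of block
      \<open>i\<close>.\<close>
    have "d * Suc i \<le> 2 * d + d * (i - 1)" by (cases i) auto
    then show "j < lookahead f (Suc (d * (i - 1)))" using that f[of "d * (i - 1)"] by linarith
  qed
  then show ?thesis by (simp add: source_def in_block_def length_replies add.commute)
qed

text \<open>The simulated and the pumped play agree block by block in end state and summary, and the
  simulated blocks have the fixed length \<open>d\<close>, so acceptance passes from the pumped play
  to the simulated one.\<close>

lemma limit_transfer:
  assumes X: "causal f X" and f: "\<And>r. 2 * d + r \<le> lookahead f (Suc r)"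
    and L: "(\<lambda>j. (list_limit (inputs v) j, v j)) \<in> lang delta qI Omega Cst"
  shows "(\<lambda>j. (X (list_limit (replies v)) j, list_limit (replies v) j)) \<in> lang delta qI Omega Cst"
proof -
  define w where "w = (\<lambda>j. (X (list_limit (replies v)) j, list_limit (replies v) j))"
  define w' where "w' = (\<lambda>j. (list_limit (inputs v) j, v j))"
  define B where "B i = d * i" for i
  define B' where "B' i = length (inputs v i)" for i
  have "strict_mono B" unfolding B_def strict_mono_Suc_iff using d by simp
  have "strict_mono B'" unfolding B'_def by (rule strict_mono_inputs)
  have le: "B i \<le> B (Suc i)" "B' i \<le> B' (Suc i)" for i
    using \<open>strict_mono B\<close> \<open>strict_mono B'\<close> by (simp_all add: strict_mono_less_eq)
  have w: "map w [B i..<B (Suc i)] = zip (source v i) (reply v i)" for i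
  proof -
    have y: "map (list_limit (replies v)) [B i..<B (Suc i)] = reply v i"
      using list_limit_segment[of "replies v", OF stage_Suc(1) reply_nonempty, of i]
      by (simp add: B_def length_replies)
    have x: "map (X (list_limit (replies v))) [B i..<B (Suc i)] = source v i"
      unfolding B_def by (rule limit_source[OF X f])
    show ?thesis
      unfolding w_def x[symmetric] y[symmetric] zip_map_map by (simp add: zip_same_conv_map)
  qed
  have w': "map w' [B' i..<B' (Suc i)] = target_play v i" for i
  proof -
    have x: "map (list_limit (inputs v)) [B' i..<B' (Suc i)] = target v i"
      using list_limit_segment[of "inputs v", OF stage_Suc(2) target_nonempty, of i]
      by (simp add: B'_def)
    show ?thesis
      unfolding w'_def target_play_eq x[symmetric] B'_def zip_map_map by (simp add: zip_same_conv_map)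
  qed
  have runs: "run delta qI w (B i) = state v i \<and> run delta qI w' (B' i) = state v i" for i
  proof (induction i)
    case 0
    then show ?case by (simp add: B_def B'_def)
  next
    case (Suc i)
    then show ?case
      using eff_run[OF le(1), of w i] eff_run[OF le(2), of w' i]
      by (simp add: w w' reply(2) stage_Suc(3))
  qed
  have "bounded_resp (\<lambda>j. Omega (run delta qI w j)) (\<lambda>j. Cst (run delta qI w j) (w j))"
  proof (rule bounded_resp_transfer[OF \<open>strict_mono B\<close> _ \<open>strict_mono B'\<close>, where d = d])
    show "bounded_resp (\<lambda>j. Omega (run delta qI w' j)) (\<lambda>j. Cst (run delta qI w' j) (w' j))"
      using L by (simp add: lang_iff w'_def)
    show "block_summary (\<lambda>j. Omega (run delta qI w j)) (\<lambda>j. Cst (run delta qI w j) (w j)) (B i) (B (Suc i)) =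
      block_summary (\<lambda>j. Omega (run delta qI w' j)) (\<lambda>j. Cst (run delta qI w' j) (w' j)) (B' i) (B' (Suc i))" for i
      using eff_run[OF le(1), of w i] eff_run[OF le(2), of w' i]
      by (simp add: w w' runs reply(2))
  qed (simp_all add: B_def B'_def)
  then show ?thesis by (simp add: lang_iff w_def)
qed

end

lemma causal_inputs:
  assumes d: "card (range block_type) \<le> d" "0 < d" and g: "g = lookahead f'"
  shows "causal f' (\<lambda>v. list_limit (inputs v))"
proof -
  have "list_limit (inputs v) j = list_limit (inputs v') j"
    if v: "\<forall>t<r. v t = v' t" and j: "j < lookahead f' (Suc r)" for v v' r j
  proof -
    note mono = strict_mono_inputs[OF d, of v]
    \<comment> \<open>The answers before round \<open>r\<close> cover the first \<open>i\<close>
      pumped blocks and thus determine \<open>i + 2\<close> blocks; the last of these is long enough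
      to supply all letters due by round \<open>r\<close>.\<close>
    obtain i where i: "length (inputs v i) \<le> r" "r < length (inputs v (Suc i))"
      using strict_mono_block[OF mono] by auto
    have eq: "inputs v (Suc (Suc i)) = inputs v' (Suc (Suc i))"
      using i v by (intro inputs_local) auto
    have "j < lookahead f' (length (inputs v (Suc i)))"
      using j i lookahead_mono[of "Suc r" "length (inputs v (Suc i))" f'] by linarith
    also have "\<dots> < length (target v (Suc i))" using target(2)[OF d] g by simp
    also have "\<dots> \<le> length (inputs v (Suc (Suc i)))" by (simp add: stage_Suc(2)[of _ "Suc i"])
    finally have len: "j < length (inputs v (Suc (Suc i)))" .
    then show ?thesis
      using list_limit_nth[of "inputs v", OF stage_Suc(2) target_nonempty[OF d] len]
        list_limit_nth[of "inputs v'", OF stage_Suc(2) target_nonempty[OF d], of j "Suc (Suc i)"] eq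
      by simp
  qed
  then show ?thesis unfolding causal_def by blast
qed

end

text \<open>If Player O won some play against the pumped strategy, the translated answers would win
  against \<open>X\<close>, a contradiction.\<close>

lemma wins_I_transfer:
  assumes f: "delay_fun f" and f': "delay_fun f'"
    and d: "card (range block_type) \<le> d" "2 * d \<le> f 0"
    and win: "wins_I f (lang delta qI Omega Cst)"
  shows "wins_I f' (lang delta qI Omega Cst)"
proof -
  have "0 < card (range block_type)" using finite_block_types by (simp add: card_gt_0_iff)
  with d have d0: "0 < d" by simp
  have look: "2 * d + r \<le> lookahead f (Suc r)" for r
  proof (induction r)
    case 0
    then show ?case using d by (simp add: lookahead_def)
  next
    case (Suc r)
    have "0 < f (Suc r)" using f by (simp add: delay_fun_def)
    then show ?case using Suc by (simp add: lookahead_def)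
  qed
  obtain X :: "(nat \<Rightarrow> 'o) \<Rightarrow> nat \<Rightarrow> 'i" where X: "causal f X"
    and L: "\<And>v. (\<lambda>j. (X v j, v j)) \<notin> lang delta qI Omega Cst"
    using win unfolding wins_I_iff[OF f] by blast
  show ?thesis
    unfolding wins_I_iff[OF f']
    using causal_inputs[OF d(1) d0 refl] limit_transfer[OF d(1) d0 X look] L by blast
qed

end

theorem theorem1:
  fixes delta :: "'q::finite \<Rightarrow> ('i::finite \<times> 'o::finite) \<Rightarrow> 'q"
    and qI :: 'q and Omega :: "'q \<Rightarrow> nat" and Cst :: "'q \<Rightarrow> 'i \<times> 'o \<Rightarrow> bool"
    and n k :: nat and f :: "nat \<Rightarrow> nat"
  assumes "\<exists>q. even (Omega q)" and "\<exists>q. odd (Omega q)"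
    and "n = card (UNIV :: 'q set)" and "k = card (range Omega)"
    and "constant_delay f" and "f 0 = 2 ^ (2 * n ^ 4 * k ^ 2 + 1)"
  shows "wins_I f (lang delta qI Omega Cst) \<longleftrightarrow>
         (\<forall>f'. delay_fun f' \<longrightarrow> wins_I f' (lang delta qI Omega Cst))"
    (is "?l \<longleftrightarrow> ?r")
proof
  assume win: ?l
  \<comment> \<open>States of both parities give \<open>n >= 2\<close>, so the \<open>k + 1\<close>
    shifted values are at most \<open>n * k\<close>; this yields the exponent with
    \<open>n ^ 4 * k ^ 2\<close>.\<close>
  obtain q q' where "even (Omega q)" "odd (Omega q')" using assms(1,2) by blast
  then have "q \<noteq> q'" by auto
  then have "2 \<le> n" unfolding assms(3) using card_mono[of UNIV "{q, q'}"] by simp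
  have "1 \<le> k" unfolding assms(4) by (simp add: Suc_le_eq card_gt_0_iff)
  then have "Suc k \<le> 2 * k" by simp
  also have "\<dots> \<le> n * k" using \<open>2 \<le> n\<close> by simp
  finally have "Suc k ^ 2 \<le> (n * k) ^ 2" by (rule power_mono) simp
  then have "2 * n ^ 2 * Suc k ^ 2 \<le> 2 * n ^ 2 * (n * k) ^ 2" by (rule mult_le_mono2)
  also have "\<dots> = 2 * n ^ 4 * k ^ 2" by (simp add: power_mult_distrib flip: power_add)
  finally have "(2::nat) ^ (2 * n ^ 2 * Suc k ^ 2) \<le> 2 ^ (2 * n ^ 4 * k ^ 2)"
    by (rule power_increasing) simp
  then have card: "card (range (cost_automaton.block_type delta Omega Cst)) \<le> 2 ^ (2 * n ^ 4 * k ^ 2)"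
    using cost_automaton.card_block_types[of delta Omega Cst, folded assms(3,4)] by (rule order_trans[rotated])
  have "delay_fun f" using assms(5) by (simp add: constant_delay_def)
  \<comment> \<open>The block length is \<open>d = 2 ^ (2 * n ^ 4 * k ^ 2)\<close>; the
    \<open>+ 1\<close> in the exponent of \<open>f 0\<close> provides exactly two such
    blocks.\<close>
  then show ?r
    using cost_automaton.wins_I_transfer[OF _ _ card _ win] assms(6) by simp
next
  assume ?r
  then show ?l using assms(5) by (simp add: constant_delay_def)
qed

end
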